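(* Let $s\in\{2,3,4,5,6\}$, let $\alpha_{s,0},\dots,\alpha_{s,s}$ be the coefficients of the $s$-step BDF formula and let $\beta_{s,j}=\sum_{\ell=0}^{j}\alpha_{s,\ell}$ for $j=0,\dots,s-1$. Let $\lambda\in\{1,-1\}$ and let $u$ be a smooth solution of $iu_t+\Delta u-\lambda|u|^2u=0$ on $\overline{\mathcal{D}}\times[0,T]$. For $\tau>0$, $t_n=n\tau$, put $\widetilde R(t_n):=\sum_{j=0}^{s-1}\beta_{s,j}u(t_{n-j})$, and for $n\ge s-1$ with $t_{n+1}\le T$ define the local truncation error of the modified $s$-step BDF scheme by $$ TE^n:=\frac{i}{\tau}\bigl(\widetilde R(t_{n+1})-\widetilde R(t_n)\bigr)+\frac12\bigl(\Delta\widetilde R(t_{n+1})+\Delta\widetilde R(t_n)\bigr)-\frac{\lambda}{4}\bigl(|\widetilde R(t_{n+1})|^2+|\widetilde R(t_n)|^2\bigr)\bigl(\widetilde R(t_{n+1})+\widetilde R(t_n)\bigr). $$ Then $TE^n=O(\tau^2)$; that is, there is a constant $C$, independent of $\tau$ and $n$, such that $\sup_{x\in\mathcal{D}}|TE^n(x)|\le C\tau^2$ for all such $\tau$ and $n$.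
   Context: $\mathcal{D}\subset\mathbf{R}^d$ ($d=1,2,3$) is a bounded domain, $T>0$, $i=\sqrt{-1}$, and $u:\overline{\mathcal{D}}\times[0,T]\to\mathbf{C}$ is of class $C^\infty$ up to the boundary; $u(t)$ denotes the function $x\mapsto u(x,t)$. The $s$-step BDF formula approximates $u_t(t_{n+1})$ by $\frac1\tau\sum_{j=0}^s\alpha_{s,j}u^{n+1-j}$, with $(\alpha_{s,0},\dots,\alpha_{s,s})$ equal to $s=2$: $(\frac32,-2,\frac12)$; $s=3$: $(\frac{11}{6},-3,\frac32,-\frac13)$; $s=4$: $(\frac{25}{12},-4,3,-\frac43,\frac14)$; $s=5$: $(\frac{137}{60},-5,5,-\frac{10}{3},\frac54,-\frac15)$; $s=6$: $(\frac{147}{60},-6,\frac{15}{2},-\frac{20}{3},\frac{15}{4},-\frac65,\frac16)$. The modified BDF scheme is, with $R^n=\sum_{j=0}^{s-1}\beta_{s,j}u^{n-j}$ and $R^{n+1/2}=\frac12(R^{n+1}+R^n)$, $$\frac{i}{\tau}(R^{n+1}-R^n)=-\Delta R^{n+1/2}+\frac{\lambda}{2}\bigl(|R^{n+1}|^2+|R^n|^2\bigr)R^{n+1/2}.$$ *)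

theory Defs
  imports "HOL-Analysis.Analysis"
begin

text \<open>
  The partial derivative of \<open>f\<close> in direction \<open>b\<close> on the open set \<open>U\<close>, extended to boundary
  points by its limit from inside \<open>U\<close>. Inside \<open>U\<close> it only depends on \<open>f\<close> restricted to \<open>U\<close>.
\<close>
definition ext_pderiv ::
  "'a::euclidean_space set \<Rightarrow> 'a \<Rightarrow> ('a \<Rightarrow> 'b::real_normed_vector) \<Rightarrow> 'a \<Rightarrow> 'b" where
  "ext_pderiv U b f x =
     (if x \<in> U then vector_derivative (\<lambda>h. f (x + h *\<^sub>R b)) (at 0)
      else Lim (at x within U) (\<lambda>y. vector_derivative (\<lambda>h. f (y + h *\<^sub>R b)) (at 0)))"

text \<open>
  The space \<open>C\<^sup>k\<close> of the closure of an open set \<open>U\<close>: all partial derivatives of order at most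
  \<open>k\<close> exist in \<open>U\<close> and extend continuously to the closure.
\<close>
fun Ck_closure :: "nat \<Rightarrow> 'a::euclidean_space set \<Rightarrow> ('a \<Rightarrow> 'b::real_normed_vector) \<Rightarrow> bool" where
  "Ck_closure 0 U f \<longleftrightarrow> continuous_on (closure U) f"
| "Ck_closure (Suc k) U f \<longleftrightarrow> continuous_on (closure U) f \<and>
     (\<forall>b\<in>Basis. (\<forall>x\<in>U. (\<lambda>h. f (x + h *\<^sub>R b)) differentiable at (0::real)) \<and>
                Ck_closure k U (ext_pderiv U b f))"

definition smooth_closure :: "'a::euclidean_space set \<Rightarrow> ('a \<Rightarrow> 'b::real_normed_vector) \<Rightarrow> bool" where
  "smooth_closure U f \<longleftrightarrow> (\<forall>k. Ck_closure k U f)"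

text \<open>The classical Laplacian at points of the open set \<open>U\<close>, its limit from inside on the boundary.\<close>
definition laplacian ::
  "'a::euclidean_space set \<Rightarrow> ('a \<Rightarrow> 'b::real_normed_vector) \<Rightarrow> 'a \<Rightarrow> 'b" where
  "laplacian U f x = (\<Sum>b\<in>Basis. ext_pderiv U b (ext_pderiv U b f) x)"

text \<open>
  At \<open>t = 0\<close> and \<open>t = T\<close> the time derivative is one-sided.
\<close>
definition nls_solution ::
  "'a::euclidean_space set \<Rightarrow> real \<Rightarrow> real \<Rightarrow> ('a \<Rightarrow> real \<Rightarrow> complex) \<Rightarrow> bool" where
  "nls_solution D T lam u \<longleftrightarrow>
     (\<forall>x\<in>closure D. \<forall>t\<in>{0..T}.
        \<i> * vector_derivative (u x) (at t within {0..T}) + laplacian D (\<lambda>y. u y t) x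
          - of_real lam * of_real ((cmod (u x t))\<^sup>2) * u x t = 0)"

definition bdf_coeffs :: "nat \<Rightarrow> real list" where
  "bdf_coeffs s =
     (if s = 2 then [3/2, -2, 1/2]
      else if s = 3 then [11/6, -3, 3/2, -1/3]
      else if s = 4 then [25/12, -4, 3, -4/3, 1/4]
      else if s = 5 then [137/60, -5, 5, -10/3, 5/4, -1/5]
      else if s = 6 then [147/60, -6, 15/2, -20/3, 15/4, -6/5, 1/6]
      else [])"

definition bdf_alpha :: "nat \<Rightarrow> nat \<Rightarrow> real" where
  "bdf_alpha s j = bdf_coeffs s ! j"

definition bdf_beta :: "nat \<Rightarrow> nat \<Rightarrow> real" where
  "bdf_beta s j = (\<Sum>l\<le>j. bdf_alpha s l)"

text \<open>\<open>bdf_R s \<tau> u n\<close> is the function \<open>x \<mapsto> R(t\<^sub>n)(x)\<close>, where \<open>t\<^sub>n = n \<tau>\<close>.\<close>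
definition bdf_R :: "nat \<Rightarrow> real \<Rightarrow> ('a \<Rightarrow> real \<Rightarrow> complex) \<Rightarrow> nat \<Rightarrow> 'a \<Rightarrow> complex" where
  "bdf_R s \<tau> u n x = (\<Sum>j<s. of_real (bdf_beta s j) * u x ((real n - real j) * \<tau>))"

definition trunc_err ::
  "'a::euclidean_space set \<Rightarrow> nat \<Rightarrow> real \<Rightarrow> real \<Rightarrow> ('a \<Rightarrow> real \<Rightarrow> complex) \<Rightarrow> nat \<Rightarrow> 'a \<Rightarrow> complex" where
  "trunc_err D s lam \<tau> u n x =
     (let R0 = bdf_R s \<tau> u n; R1 = bdf_R s \<tau> u (n + 1) in
        \<i> / of_real \<tau> * (R1 x - R0 x)
        + 1 / 2 * (laplacian D R1 x + laplacian D R0 x)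
        - of_real (lam / 4) * of_real ((cmod (R1 x))\<^sup>2 + (cmod (R0 x))\<^sup>2) * (R1 x + R0 x))"

end

theory Submission
  imports Defs
begin

text \<open>
  Fix \<open>x \<in> D\<close> and expand everything in time about \<open>t = t\<^sub>n\<^sub>+\<^sub>1\<close>. Of the BDF
  coefficients only two consequences matter, namely \<open>\<Sum>j. \<beta>\<^sub>j = 1\<close> and
  \<open>\<Sum>j. j \<beta>\<^sub>j = -1/2\<close> (\<open>bdf_beta_moments\<close>). They say that \<open>R\<^sup>n\<^sup>+\<^sup>1\<close> agrees with
  \<open>u(t + \<tau>/2)\<close>, and \<open>R\<^sup>n\<close> with \<open>u(t - \<tau>/2)\<close>, through the linear terms in \<open>\<tau>\<close>. The scheme is
  therefore symmetric about \<open>t\<close> to this order, and it is consistent at \<open>t\<close> rather than at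
  the midpoint of \<open>t\<^sub>n\<close> and \<open>t\<^sub>n\<^sub>+\<^sub>1\<close>:

  \<^item> the mean of \<open>R\<^sup>n\<^sup>+\<^sup>1\<close> and \<open>R\<^sup>n\<close> is \<open>u(t) + O(\<tau>\<^sup>2)\<close>, because the linear terms cancel
    (\<open>shift_avg_mean\<close>); the same applies to every second space derivative of \<open>u\<close>;
  \<^item> the difference \<open>R\<^sup>n\<^sup>+\<^sup>1 - R\<^sup>n\<close> is \<open>\<tau> u\<^sub>t(t) + O(\<tau>\<^sup>3)\<close>, because the quadratic terms cancel
    (\<open>shift_avg_difference\<close>);
  \<^item> by the parallelogram law the cubic term sees only the mean and the square of the
    difference, so it is \<open>\<bar>u(t)\<bar>\<^sup>2 u(t) + O(\<tau>\<^sup>2)\<close> (\<open>cubic_consistency\<close>).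

  Inserting these expansions leaves the equation at \<open>(x, t)\<close>, which vanishes, plus \<open>O(\<tau>\<^sup>2)\<close>.

  The constants are uniform in \<open>x\<close> because the derivatives involved are continuous on the
  compact set \<open>closure D \<times> {0..T}\<close>. The times \<open>0\<close> and \<open>T\<close> do occur in the scheme, whereas
  smoothness is assumed as differentiability in the open cylinder together with continuous
  extension of the derivatives. The fundamental theorem of calculus turns this into
  differentiability at the end times, one-sided in time (\<open>smooth_closure_time_derivative\<close>)
  and within the time slices in space (\<open>smooth_closure_space_derivative\<close>).

  Space derivatives are always taken before time derivatives, so mixed derivatives never have
  to be interchanged.
\<close>

section \<open>Taylor expansion backwards in time\<close>

text \<open>
  The shifts in the scheme reach into the past, hence the expansion to the left. As a function
  of \<open>h\<close> the remainder vanishes at \<open>0\<close>, and its derivative is, up to sign, the remainder of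
  order \<open>k - 1\<close> for \<open>F (Suc 0)\<close>. Induction by the mean value inequality gives the bound; the factor
  \<open>1 / fact k\<close> is lost on the way, but only the power of \<open>h\<close> matters.
\<close>
lemma taylor_backward:
  fixes F :: "nat \<Rightarrow> real \<Rightarrow> 'b::real_normed_vector"
  assumes "\<And>i t. i < k \<Longrightarrow> t \<in> {0..T} \<Longrightarrow>
             (F i has_vector_derivative F (Suc i) t) (at t within {0..T})"
    and "\<And>t. t \<in> {0..T} \<Longrightarrow> norm (F k t) \<le> M"
    and "0 \<le> h" "h \<le> t" "t \<le> T"
  shows "norm (F 0 (t - h) - (\<Sum>i<k. ((- h) ^ i / fact i) *\<^sub>R F i t)) \<le> M * h ^ k"
  using assms
proof (induction k arbitrary: F h)
  case 0
  then show ?case by simp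
next
  case (Suc k)
  define E where "E h = F 0 (t - h) - (\<Sum>i<Suc k. ((- h) ^ i / fact i) *\<^sub>R F i t)" for h
  define E' where "E' h = - (F 1 (t - h) - (\<Sum>i<k. ((- h) ^ i / fact i) *\<^sub>R F (Suc i) t))" for h
  have E_deriv: "(E has_vector_derivative E' y) (at y within {0..h})" if y: "y \<in> {0..h}" for y
  proof -
    have "((\<lambda>y. F 0 (t - y)) has_vector_derivative (-1) *\<^sub>R F 1 (t - y)) (at y within {0..h})"
    proof (rule vector_diff_chain_within[unfolded o_def])
      show "((-) t has_vector_derivative - 1) (at y within {0..h})"
        by (auto intro!: derivative_eq_intros)
      have "(F 0 has_vector_derivative F (Suc 0) (t - y)) (at (t - y) within {0..T})"
        using Suc.prems(3-5) y by (intro Suc.prems(1)) auto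
      then show "(F 0 has_vector_derivative F 1 (t - y)) (at (t - y) within (-) t ` {0..h})"
        using Suc.prems(3-5)
        by (auto intro: has_vector_derivative_within_subset)
    qed
    moreover have "((\<lambda>y. \<Sum>i<Suc k. ((- y) ^ i / fact i) *\<^sub>R F i t) has_vector_derivative
        - (\<Sum>i<k. ((- y) ^ i / fact i) *\<^sub>R F (Suc i) t)) (at y within {0..h})"
    proof -
      have summand: "((\<lambda>y. ((- y) ^ Suc i / fact (Suc i)) *\<^sub>R F (Suc i) t) has_vector_derivative
          - (((- y) ^ i / fact i) *\<^sub>R F (Suc i) t)) (at y within {0..h})" for i
      proof -
        have "((\<lambda>y::real. (- y) ^ Suc i) has_real_derivative - (real (Suc i) * (- y) ^ i))
            (at y within {0..h})"
          by (auto intro!: derivative_eq_intros simp del: power_Suc)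
        then have "((\<lambda>y::real. (- y) ^ Suc i / fact (Suc i)) has_real_derivative
            - (real (Suc i) * (- y) ^ i) / fact (Suc i)) (at y within {0..h})"
          by (rule DERIV_cdivide)
        also have "- (real (Suc i) * (- y) ^ i) / fact (Suc i) = - ((- y) ^ i / fact i)"
          unfolding fact_Suc by (simp del: of_nat_Suc)
        finally show ?thesis
          using has_vector_derivative_scaleR[OF _ has_vector_derivative_const] by fastforce
      qed
      have "((\<lambda>y. F 0 t + (\<Sum>i<k. ((- y) ^ Suc i / fact (Suc i)) *\<^sub>R F (Suc i) t)) has_vector_derivative
          0 + (\<Sum>i<k. - (((- y) ^ i / fact i) *\<^sub>R F (Suc i) t))) (at y within {0..h})"
        by (intro has_vector_derivative_add has_vector_derivative_const has_vector_derivative_sum summand)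
      then show ?thesis
        unfolding sum.lessThan_Suc_shift by (simp add: sum_negf)
    qed
    ultimately have "(E has_vector_derivative
        ((-1) *\<^sub>R F 1 (t - y) - - (\<Sum>i<k. ((- y) ^ i / fact i) *\<^sub>R F (Suc i) t))) (at y within {0..h})"
      unfolding E_def[abs_def] by (rule has_vector_derivative_diff)
    then show ?thesis by (simp add: E'_def)
  qed
  have "norm (E' y) \<le> M * h ^ k" if y: "y \<in> {0..h}" for y
  proof -
    have "norm (E' y) \<le> M * y ^ k"
      unfolding E'_def norm_minus_cancel One_nat_def
      by (rule Suc.IH[of "\<lambda>i. F (Suc i)"]) (use Suc.prems y in auto)
    also have "\<dots> \<le> M * h ^ k"
    proof -
      have "0 \<le> norm (F (Suc k) 0)" by simp
      also have "\<dots> \<le> M" using Suc.prems(3-5) by (intro Suc.prems(2)) auto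
      finally show ?thesis using y by (intro mult_left_mono power_mono) auto
    qed
    finally show ?thesis .
  qed
  then have "onorm (\<lambda>d. d *\<^sub>R E' y) \<le> M * h ^ k" if "y \<in> {0..h}" for y
    using that by (intro onorm_le) (auto simp: mult.commute[of "M * h ^ k"] intro!: mult_left_mono)
  then have "norm (E h - E 0) \<le> M * h ^ k * norm (h - 0)"
    using Suc.prems(3) E_deriv
    by (intro differentiable_bound[of "{0..h}" E "\<lambda>y d. d *\<^sub>R E' y"])
      (auto simp: has_vector_derivative_def)
  moreover have "E 0 = 0"
    unfolding E_def sum.lessThan_Suc_shift by simp
  ultimately show ?case
    using Suc.prems(3) by (simp add: E_def mult_ac)
qed

section \<open>Weighted averages of time shifts\<close>

lemma norm_weighted_sum_le:
  fixes G :: "nat \<Rightarrow> 'b::real_normed_vector" and \<beta> :: "nat \<Rightarrow> real"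
  assumes "\<And>j. j < s \<Longrightarrow> norm (G j) \<le> K"
  shows "norm (\<Sum>j<s. \<beta> j *\<^sub>R G j) \<le> (\<Sum>j<s. \<bar>\<beta> j\<bar>) * K"
proof -
  have "norm (\<Sum>j<s. \<beta> j *\<^sub>R G j) \<le> (\<Sum>j<s. \<bar>\<beta> j\<bar> * K)"
    using assms by (intro sum_norm_le) (auto intro!: mult_left_mono)
  then show ?thesis by (simp add: sum_distrib_right)
qed

text \<open>
  With \<open>t = t\<^sub>n\<^sub>+\<^sub>1\<close> and the BDF weights, \<open>k = 0\<close> gives \<open>R\<^sup>n\<^sup>+\<^sup>1\<close> and \<open>k = 1\<close> gives \<open>R\<^sup>n\<close>.
\<close>
definition shift_avg :: "nat \<Rightarrow> (nat \<Rightarrow> real) \<Rightarrow> real \<Rightarrow> nat \<Rightarrow> (real \<Rightarrow> 'b) \<Rightarrow> real \<Rightarrow> 'b::real_normed_vector" where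
  "shift_avg s \<beta> \<tau> k g t = (\<Sum>j<s. \<beta> j *\<^sub>R g (t - real (j + k) * \<tau>))"

text \<open>
  The pair of shifts \<open>j \<tau>\<close> and \<open>(j + 1) \<tau>\<close> has mean \<open>(j + 1/2) \<tau>\<close>, and the moment conditions say
  that \<open>j + 1/2\<close> has weighted sum \<open>0\<close>: this removes the linear term.
\<close>
lemma shift_avg_mean:
  fixes F :: "nat \<Rightarrow> real \<Rightarrow> 'b::real_normed_vector"
  assumes deriv: "\<And>i t. i < 2 \<Longrightarrow> t \<in> {0..T} \<Longrightarrow>
             (F i has_vector_derivative F (Suc i) t) (at t within {0..T})"
    and bound: "\<And>t. t \<in> {0..T} \<Longrightarrow> norm (F 2 t) \<le> M"
    and moments: "(\<Sum>j<s. \<beta> j) = 1" "(\<Sum>j<s. real j * \<beta> j) = - 1 / 2"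
    and "0 < \<tau>" "real s * \<tau> \<le> t" "t \<le> T"
  shows "norm ((1/2) *\<^sub>R (shift_avg s \<beta> \<tau> 0 (F 0) t + shift_avg s \<beta> \<tau> 1 (F 0) t) - F 0 t)
           \<le> (\<Sum>j<s. \<bar>\<beta> j\<bar>) * (M * (real s)\<^sup>2) * \<tau>\<^sup>2"
proof -
  define r where "r h = F 0 (t - h) - (F 0 t - h *\<^sub>R F 1 t)" for h
  have t: "0 \<le> t" using assms(5,6) by (smt (verit) mult_nonneg_nonneg of_nat_0_le_iff)
  have "0 \<le> norm (F 2 t)" by simp
  also have "\<dots> \<le> M" using t \<open>t \<le> T\<close> by (intro bound) auto
  finally have M: "0 \<le> M" .
  have r: "norm (r (real m * \<tau>)) \<le> M * (real s)\<^sup>2 * \<tau>\<^sup>2" if m: "m \<le> s" for m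
  proof -
    have ms: "real m * \<tau> \<le> real s * \<tau>" using m \<open>0 < \<tau>\<close> by simp
    have "norm (r (real m * \<tau>)) \<le> M * (real m * \<tau>)\<^sup>2"
      using taylor_backward[of 2 T F M "real m * \<tau>" t] deriv bound assms(5-7) ms
      by (simp add: r_def numeral_2_eq_2)
    also have "\<dots> \<le> M * (real s * \<tau>)\<^sup>2"
      using M ms \<open>0 < \<tau>\<close> by (intro mult_left_mono power_mono) auto
    finally show ?thesis by (simp add: power_mult_distrib mult.assoc)
  qed
  have "(1/2) *\<^sub>R (shift_avg s \<beta> \<tau> 0 (F 0) t + shift_avg s \<beta> \<tau> 1 (F 0) t)
      = (\<Sum>j<s. \<beta> j *\<^sub>R ((1/2) *\<^sub>R (r (real j * \<tau>) + r (real (Suc j) * \<tau>))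
           + (F 0 t - ((real j + 1/2) * \<tau>) *\<^sub>R F 1 t)))"
    unfolding shift_avg_def sum.distrib[symmetric] scaleR_sum_right r_def
    by (intro sum.cong refl) (simp add: algebra_simps flip: scaleR_add_left scaleR_2)
  also have "\<dots> = (\<Sum>j<s. \<beta> j *\<^sub>R ((1/2) *\<^sub>R (r (real j * \<tau>) + r (real (Suc j) * \<tau>))))
      + (\<Sum>j<s. \<beta> j) *\<^sub>R F 0 t - (((\<Sum>j<s. real j * \<beta> j) + (\<Sum>j<s. \<beta> j) / 2) * \<tau>) *\<^sub>R F 1 t"
    by (simp add: sum.distrib sum_subtractf scaleR_sum_left sum_distrib_left sum_distrib_right sum_divide_distrib
        scaleR_add_right scaleR_diff_right algebra_simps)
  also have "\<dots> = (\<Sum>j<s. \<beta> j *\<^sub>R ((1/2) *\<^sub>R (r (real j * \<tau>) + r (real (Suc j) * \<tau>)))) + F 0 t"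
    by (simp add: moments)
  finally have "(1/2) *\<^sub>R (shift_avg s \<beta> \<tau> 0 (F 0) t + shift_avg s \<beta> \<tau> 1 (F 0) t) - F 0 t
      = (\<Sum>j<s. \<beta> j *\<^sub>R ((1/2) *\<^sub>R (r (real j * \<tau>) + r (real (Suc j) * \<tau>))))" by simp
  moreover have "norm ((1/2) *\<^sub>R (r (real j * \<tau>) + r (real (Suc j) * \<tau>))) \<le> M * (real s)\<^sup>2 * \<tau>\<^sup>2"
    if "j < s" for j
    using norm_triangle_ineq[of "r (real j * \<tau>)" "r (real (Suc j) * \<tau>)"]
      r[of j] r[of "Suc j"] that by simp
  ultimately show ?thesis
    using norm_weighted_sum_le[of s "\<lambda>j. (1/2) *\<^sub>R (r (real j * \<tau>) + r (real (Suc j) * \<tau>))"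
        "M * (real s)\<^sup>2 * \<tau>\<^sup>2" \<beta>]
    by (simp add: mult.assoc)
qed

text \<open>
  Since \<open>((j + 1)\<^sup>2 - j\<^sup>2) / 2 = j + 1/2\<close>, the quadratic Taylor term of the difference carries the
  same weighted sum as the linear term of the mean, and vanishes for the same reason. One order
  more than for the mean is needed because the scheme divides the difference by \<open>\<tau>\<close>.
\<close>
lemma shift_avg_difference:
  fixes F :: "nat \<Rightarrow> real \<Rightarrow> 'b::real_normed_vector"
  assumes deriv: "\<And>i t. i < 3 \<Longrightarrow> t \<in> {0..T} \<Longrightarrow>
             (F i has_vector_derivative F (Suc i) t) (at t within {0..T})"
    and bound: "\<And>t. t \<in> {0..T} \<Longrightarrow> norm (F 3 t) \<le> M"
    and moments: "(\<Sum>j<s. \<beta> j) = 1" "(\<Sum>j<s. real j * \<beta> j) = - 1 / 2"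
    and "0 < \<tau>" "real s * \<tau> \<le> t" "t \<le> T"
  shows "norm (shift_avg s \<beta> \<tau> 0 (F 0) t - shift_avg s \<beta> \<tau> 1 (F 0) t - \<tau> *\<^sub>R F 1 t)
           \<le> (\<Sum>j<s. \<bar>\<beta> j\<bar>) * (2 * M * real s ^ 3) * \<tau> ^ 3"
proof -
  define r where "r h = F 0 (t - h) - (F 0 t - h *\<^sub>R F 1 t + (h\<^sup>2 / 2) *\<^sub>R F 2 t)" for h
  have t: "0 \<le> t" using assms(5,6) by (smt (verit) mult_nonneg_nonneg of_nat_0_le_iff)
  have "0 \<le> norm (F 3 t)" by simp
  also have "\<dots> \<le> M" using t \<open>t \<le> T\<close> by (intro bound) auto
  finally have M: "0 \<le> M" .
  have r: "norm (r (real m * \<tau>)) \<le> M * real s ^ 3 * \<tau> ^ 3" if m: "m \<le> s" for m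
  proof -
    have ms: "real m * \<tau> \<le> real s * \<tau>" using m \<open>0 < \<tau>\<close> by simp
    have "norm (r (real m * \<tau>)) \<le> M * (real m * \<tau>) ^ 3"
      using taylor_backward[of 3 T F M "real m * \<tau>" t] deriv bound assms(5-7) ms
      by (simp add: r_def numeral_3_eq_3 numeral_2_eq_2)
    also have "\<dots> \<le> M * (real s * \<tau>) ^ 3"
      using M ms \<open>0 < \<tau>\<close> by (intro mult_left_mono power_mono) auto
    finally show ?thesis by (simp add: power_mult_distrib mult.assoc)
  qed
  have square: "((a + \<tau>)\<^sup>2 / 2) *\<^sub>R y = (a\<^sup>2 / 2) *\<^sub>R y + (a * \<tau> + \<tau>\<^sup>2 / 2) *\<^sub>R y" for a and y :: 'b
    unfolding scaleR_add_left[symmetric]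
    by (rule arg_cong[where f = "\<lambda>c. c *\<^sub>R y"]) (simp add: power2_eq_square field_simps)
  have step: "F 0 (t - real (j + 0) * \<tau>) - F 0 (t - real (j + 1) * \<tau>)
      = (r (real j * \<tau>) - r (real (Suc j) * \<tau>)) + \<tau> *\<^sub>R F 1 t
        - ((real j + 1/2) * \<tau>\<^sup>2) *\<^sub>R F 2 t" for j
  proof -
    define a where "a = real j * \<tau>"
    have "real (j + 0) * \<tau> = a" "real (j + 1) * \<tau> = a + \<tau>" "real (Suc j) * \<tau> = a + \<tau>"
      "(real j + 1/2) * \<tau>\<^sup>2 = a * \<tau> + \<tau>\<^sup>2 / 2"
      by (simp_all add: a_def algebra_simps power2_eq_square)
    then show ?thesis
      unfolding a_def[symmetric] by (simp add: r_def square scaleR_add_left)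
  qed
  have "shift_avg s \<beta> \<tau> 0 (F 0) t - shift_avg s \<beta> \<tau> 1 (F 0) t
      = (\<Sum>j<s. \<beta> j *\<^sub>R ((r (real j * \<tau>) - r (real (Suc j) * \<tau>)) + \<tau> *\<^sub>R F 1 t
        - ((real j + 1/2) * \<tau>\<^sup>2) *\<^sub>R F 2 t))"
    unfolding shift_avg_def sum_subtractf[symmetric] scaleR_diff_right[symmetric] step ..
  also have "\<dots> = (\<Sum>j<s. \<beta> j *\<^sub>R (r (real j * \<tau>) - r (real (Suc j) * \<tau>)))
      + ((\<Sum>j<s. \<beta> j) * \<tau>) *\<^sub>R F 1 t
      - (((\<Sum>j<s. real j * \<beta> j) + (\<Sum>j<s. \<beta> j) / 2) * \<tau>\<^sup>2) *\<^sub>R F 2 t"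
    by (simp add: sum.distrib sum_subtractf scaleR_sum_left sum_distrib_left sum_distrib_right sum_divide_distrib
        scaleR_add_right scaleR_diff_right algebra_simps)
  finally have "shift_avg s \<beta> \<tau> 0 (F 0) t - shift_avg s \<beta> \<tau> 1 (F 0) t - \<tau> *\<^sub>R F 1 t
      = (\<Sum>j<s. \<beta> j *\<^sub>R (r (real j * \<tau>) - r (real (Suc j) * \<tau>)))"
    by (simp add: moments)
  moreover have "norm (r (real j * \<tau>) - r (real (Suc j) * \<tau>)) \<le> 2 * M * real s ^ 3 * \<tau> ^ 3"
    if "j < s" for j
    using norm_triangle_ineq4[of "r (real j * \<tau>)" "r (real (Suc j) * \<tau>)"]
      r[of j] r[of "Suc j"] that by simp
  ultimately show ?thesis
    using norm_weighted_sum_le[of s "\<lambda>j. r (real j * \<tau>) - r (real (Suc j) * \<tau>)"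
        "2 * M * real s ^ 3 * \<tau> ^ 3" \<beta>]
    by (simp add: mult.assoc)
qed

text \<open>
  Summation by parts turns \<open>\<Sum>j. \<alpha>\<^sub>j = 0\<close>, \<open>\<Sum>j. j \<alpha>\<^sub>j = -1\<close> and \<open>\<Sum>j. j\<^sup>2 \<alpha>\<^sub>j = 0\<close>, the conditions
  for second order accuracy of the BDF formula, into these two identities. For the five
  formulas at hand a direct evaluation is shorter.
\<close>
lemma bdf_beta_moments:
  assumes "s \<in> {2, 3, 4, 5, 6}"
  shows "(\<Sum>j<s. bdf_beta s j) = 1" and "(\<Sum>j<s. real j * bdf_beta s j) = - 1 / 2"
proof -
  have "{..<2} = {0, 1::nat}" "{..<3} = {0, 1, 2::nat}" "{..<4} = {0, 1, 2, 3::nat}"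
    "{..<5} = {0, 1, 2, 3, 4::nat}" "{..<6} = {0, 1, 2, 3, 4, 5::nat}"
    "{..0} = {0::nat}" "{..Suc 0} = {0, 1::nat}" "{..2} = {0, 1, 2::nat}" "{..3} = {0, 1, 2, 3::nat}"
    "{..4} = {0, 1, 2, 3, 4::nat}" "{..5} = {0, 1, 2, 3, 4, 5::nat}"
    by auto
  then have "(\<Sum>j<s. bdf_beta s j) = 1 \<and> (\<Sum>j<s. real j * bdf_beta s j) = - 1 / 2"
    using assms
    by (elim insertE emptyE) (simp_all add: bdf_beta_def bdf_alpha_def bdf_coeffs_def)
  then show "(\<Sum>j<s. bdf_beta s j) = 1" "(\<Sum>j<s. real j * bdf_beta s j) = - 1 / 2"
    by blast+
qed

section \<open>The cubic nonlinearity\<close>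

lemma cubic_lipschitz:
  fixes m g :: complex
  shows "cmod (of_real ((cmod m)\<^sup>2) * m - of_real ((cmod g)\<^sup>2) * g)
    \<le> cmod (m - g) * ((cmod m)\<^sup>2 + cmod m * cmod g + (cmod g)\<^sup>2)"
proof -
  have "of_real ((cmod m)\<^sup>2) * m - of_real ((cmod g)\<^sup>2) * g
      = of_real ((cmod m)\<^sup>2) * (m - g) + of_real ((cmod m - cmod g) * (cmod m + cmod g)) * g"
    by (simp add: algebra_simps power2_eq_square)
  also have "cmod \<dots> \<le> (cmod m)\<^sup>2 * cmod (m - g) + \<bar>cmod m - cmod g\<bar> * (cmod m + cmod g) * cmod g"
    by (rule order_trans[OF norm_triangle_ineq]) (simp add: norm_mult abs_mult norm_power flip: of_real_diff of_real_add)
  also have "\<dots> \<le> (cmod m)\<^sup>2 * cmod (m - g) + cmod (m - g) * (cmod m + cmod g) * cmod g"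
    by (intro add_left_mono mult_right_mono norm_triangle_ineq3) auto
  finally show ?thesis by (simp add: algebra_simps power2_eq_square)
qed

text \<open>
  The parallelogram law expresses \<open>\<bar>a\<bar>\<^sup>2 + \<bar>b\<bar>\<^sup>2\<close> by the mean and the difference of \<open>a\<close> and \<open>b\<close>.
  There is no term linear in the difference, which is only of size \<open>O(\<tau>)\<close> in the scheme.
\<close>
lemma cubic_average:
  fixes a b :: complex
  shows "of_real ((cmod a)\<^sup>2 + (cmod b)\<^sup>2) * (a + b) / 4
    = of_real ((cmod ((a + b) / 2))\<^sup>2) * ((a + b) / 2) + of_real ((cmod (a - b))\<^sup>2 / 4) * ((a + b) / 2)"
proof -
  have "(cmod a)\<^sup>2 + (cmod b)\<^sup>2 = 2 * (cmod ((a + b) / 2))\<^sup>2 + (cmod (a - b))\<^sup>2 / 2"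
  proof -
    have "(cmod (a + b))\<^sup>2 + (cmod (a - b))\<^sup>2 = 2 * (cmod a)\<^sup>2 + 2 * (cmod b)\<^sup>2"
      unfolding cmod_power2 by (simp add: power2_eq_square algebra_simps)
    then show ?thesis by (simp add: norm_divide power_divide)
  qed
  then show ?thesis
    by (simp only: of_real_add of_real_mult) (simp add: field_simps)
qed

lemma cubic_consistency:
  fixes a b g :: complex
  assumes "cmod ((a + b) / 2 - g) \<le> A * \<tau>\<^sup>2" "cmod (a - b) \<le> B * \<tau>"
    "cmod g \<le> M" "cmod ((a + b) / 2) \<le> N" 
  shows "cmod (of_real ((cmod a)\<^sup>2 + (cmod b)\<^sup>2) * (a + b) / 4 - of_real ((cmod g)\<^sup>2) * g)
    \<le> (A * (N\<^sup>2 + N * M + M\<^sup>2) + B\<^sup>2 / 4 * N) * \<tau>\<^sup>2"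
proof -
  define m where "m = (a + b) / 2"
  note assms = assms[folded m_def]
  have MN: "0 \<le> M" "0 \<le> N" using assms norm_ge_zero order_trans by blast+
  have "cmod (of_real ((cmod a)\<^sup>2 + (cmod b)\<^sup>2) * (a + b) / 4 - of_real ((cmod g)\<^sup>2) * g)
      = cmod ((of_real ((cmod m)\<^sup>2) * m - of_real ((cmod g)\<^sup>2) * g) + of_real ((cmod (a - b))\<^sup>2 / 4) * m)"
    unfolding cubic_average m_def by (simp add: algebra_simps)
  also have "\<dots> \<le> cmod (m - g) * ((cmod m)\<^sup>2 + cmod m * cmod g + (cmod g)\<^sup>2)
      + (cmod (a - b))\<^sup>2 / 4 * cmod m"
    by (rule order_trans[OF norm_triangle_ineq])
      (intro add_mono cubic_lipschitz, simp add: norm_mult norm_power norm_divide)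
  also have "\<dots> \<le> A * \<tau>\<^sup>2 * (N\<^sup>2 + N * M + M\<^sup>2) + (B * \<tau>)\<^sup>2 / 4 * N"
    using assms MN
    by (intro add_mono mult_mono power_mono divide_right_mono add_nonneg_nonneg)
      (auto intro: order_trans[OF norm_ge_zero])
  finally show ?thesis by (simp add: power_mult_distrib algebra_simps)
qed

section \<open>Smooth functions up to the boundary\<close>

lemma smooth_closure_continuous:
  "smooth_closure U f \<Longrightarrow> continuous_on (closure U) f"
  unfolding smooth_closure_def by (metis Ck_closure.simps(1))

lemma smooth_closure_ext_pderiv:
  "smooth_closure U f \<Longrightarrow> b \<in> Basis \<Longrightarrow> smooth_closure U (ext_pderiv U b f)"
  unfolding smooth_closure_def by (metis Ck_closure.simps(2))

lemma smooth_closure_funpow_ext_pderiv: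
  "smooth_closure U f \<Longrightarrow> b \<in> Basis \<Longrightarrow> smooth_closure U ((ext_pderiv U b ^^ k) f)"
  by (induction k) (auto intro: smooth_closure_ext_pderiv)

lemma smooth_closure_bounded:
  assumes "smooth_closure U f" "bounded U"
  obtains M where "\<And>p. p \<in> closure U \<Longrightarrow> norm (f p) \<le> M"
proof -
  have "compact (f ` closure U)"
    using assms by (intro compact_continuous_image smooth_closure_continuous) (auto simp: compact_closure)
  then have "bounded (f ` closure U)" by (rule compact_imp_bounded)
  then show ?thesis using that unfolding bounded_iff by auto
qed

text \<open>
  Smoothness is stated by means of derivatives at \<open>h = 0\<close> along translated lines; for the
  fundamental theorem of calculus one line has to be differentiated at every parameter.
\<close>
lemma smooth_closure_line_derivative:
  assumes "smooth_closure U f" "b \<in> Basis" "q + h *\<^sub>R b \<in> U"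
  shows "((\<lambda>h. f (q + h *\<^sub>R b)) has_vector_derivative ext_pderiv U b f (q + h *\<^sub>R b)) (at h)"
proof -
  define p where "p = q + h *\<^sub>R b"
  have "(\<lambda>k. f (p + k *\<^sub>R b)) differentiable at 0"
    using assms unfolding smooth_closure_def p_def by (metis Ck_closure.simps(2))
  then have "((\<lambda>k. f (p + k *\<^sub>R b)) has_vector_derivative ext_pderiv U b f p) (at (h - h))"
    using assms(3) by (simp add: vector_derivative_works ext_pderiv_def p_def)
  moreover have "((\<lambda>k. k - h) has_vector_derivative 1) (at h)"
    by (auto intro!: derivative_eq_intros)
  ultimately have "((\<lambda>k. f (p + k *\<^sub>R b)) \<circ> (\<lambda>k. k - h) has_vector_derivative 1 *\<^sub>R ext_pderiv U b f p) (at h)"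
    by (intro vector_diff_chain_at) auto
  moreover have "(\<lambda>k. f (p + k *\<^sub>R b)) \<circ> (\<lambda>k. k - h) = (\<lambda>k. f (q + k *\<^sub>R b))"
    by (auto simp: p_def algebra_simps)
  ultimately show ?thesis by (simp add: p_def)
qed

lemma has_vector_derivative_of_integral_eq:
  fixes \<phi> \<psi> :: "real \<Rightarrow> 'b::banach"
  assumes "\<And>y. y \<in> {a..b} \<Longrightarrow> integral {a..y} \<psi> = \<phi> y - \<phi> a"
    and "continuous_on {a..b} \<psi>" "t \<in> {a..b}"
  shows "(\<phi> has_vector_derivative \<psi> t) (at t within {a..b})"
proof -
  have "((\<lambda>y. \<phi> a + integral {a..y} \<psi>) has_vector_derivative 0 + \<psi> t) (at t within {a..b})"
    using assms by (intro has_vector_derivative_add has_vector_derivative_const integral_has_vector_derivative) auto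
  then show ?thesis
    unfolding add_0_left
    by (rule has_vector_derivative_transform[OF assms(3), rotated]) (use assms(1) in auto)
qed

text \<open>
  For \<open>x \<in> D\<close> only the ends of the line \<open>{x} \<times> {0..T}\<close> lie outside the open cylinder. The
  fundamental theorem of calculus requires the derivative only in the interior, and
  differentiating the resulting integral yields it at the ends as well.
\<close>
lemma smooth_closure_time_derivative:
  fixes f :: "'a::euclidean_space \<times> real \<Rightarrow> 'b::banach"
  assumes f: "smooth_closure (D \<times> {0<..<T}) f" and "x \<in> D" "0 < T" "t \<in> {0..T}"
  shows "((\<lambda>t. f (x, t)) has_vector_derivative ext_pderiv (D \<times> {0<..<T}) (0, 1) f (x, t))
           (at t within {0..T})"
proof (rule has_vector_derivative_of_integral_eq)
  have b: "(0, 1) \<in> (Basis :: ('a \<times> real) set)" by (simp add: Basis_prod_def)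
  have cont: "continuous_on {0..T} (\<lambda>t. g (x, t))" if "smooth_closure (D \<times> {0<..<T}) g" 
    for g :: "'a \<times> real \<Rightarrow> 'b"
    using assms(2,3) closure_subset[of D]
    by (intro continuous_on_compose2[OF smooth_closure_continuous[OF that]] continuous_intros)
      (auto simp: closure_Times)
  show cont': "continuous_on {0..T} (\<lambda>t. ext_pderiv (D \<times> {0<..<T}) (0, 1) f (x, t))"
    by (intro cont smooth_closure_ext_pderiv f b)
  show "integral {0..y} (\<lambda>t. ext_pderiv (D \<times> {0<..<T}) (0, 1) f (x, t)) = f (x, y) - f (x, 0)"
    if y: "y \<in> {0..T}" for y
  proof (intro integral_unique fundamental_theorem_of_calculus_interior)
    show "continuous_on {0..y} (\<lambda>t. f (x, t))"
      using cont[OF f] y by (auto intro: continuous_on_subset)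
    show "((\<lambda>t. f (x, t)) has_vector_derivative ext_pderiv (D \<times> {0<..<T}) (0, 1) f (x, z)) (at z)"
      if "z \<in> {0<..<y}" for z
      using smooth_closure_line_derivative[OF f b, of "(x, 0)" z] that y assms(2) by simp
  qed (use y in auto)
qed (use assms in auto)

text \<open>
  For \<open>t = 0\<close> and \<open>t = T\<close> the whole spatial line lies on the boundary of the cylinder, where
  \<open>f\<close> is known only to be a limit. The integral form of the derivative survives the limit:
  for fixed \<open>h\<close> both sides of the fundamental theorem of calculus are continuous in \<open>t\<close>, so
  the identity passes from \<open>{0<..<T}\<close> to \<open>{0..T}\<close>, and can then be differentiated in \<open>h\<close>.
\<close>
lemma smooth_closure_space_derivative:
  fixes f :: "'a::euclidean_space \<times> real \<Rightarrow> 'b::banach"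
  assumes f: "smooth_closure (D \<times> {0<..<T}) f" and "open D" "x \<in> D" "0 < T" "t \<in> {0..T}"
    and b: "b \<in> Basis"
  shows "((\<lambda>h. f (x + h *\<^sub>R b, t)) has_vector_derivative ext_pderiv (D \<times> {0<..<T}) (b, 0) f (x, t))
           (at 0)"
proof -
  define U where "U = D \<times> {0<..<T}"
  define \<psi> where "\<psi> = ext_pderiv U (b, 0) f"
  have b0: "(b, 0) \<in> (Basis :: ('a \<times> real) set)" using b by (simp add: Basis_prod_def)
  have \<psi>: "smooth_closure U \<psi>"
    unfolding \<psi>_def U_def by (intro smooth_closure_ext_pderiv f b0)
  obtain r where r: "0 < r" "cball x r \<subseteq> D"
    using \<open>open D\<close> \<open>x \<in> D\<close> open_contains_cball by blast
  have D: "x + h *\<^sub>R b \<in> D" if "h \<in> {-r..r}" for h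
    using r(2) that b by (auto simp: dist_norm subset_iff)
  have clU: "(x + h *\<^sub>R b, t) \<in> closure U" if "h \<in> {-r..r}" "t \<in> {0..T}" for h t
    using D[OF that(1)] closure_subset[of D] that(2) \<open>0 < T\<close> by (auto simp: U_def closure_Times)
  have cont_t: "continuous_on {0..T} (\<lambda>t. f (x + h *\<^sub>R b, t))" if "h \<in> {-r..r}" for h
    using clU[OF that]
    by (intro continuous_on_compose2[OF smooth_closure_continuous[OF f]] continuous_intros)
      (auto simp: U_def)
  have ftc: "integral {-r..h} (\<lambda>k. \<psi> (x + k *\<^sub>R b, t)) = f (x + h *\<^sub>R b, t) - f (x + (-r) *\<^sub>R b, t)"
    if h: "h \<in> {-r..r}" and t: "t \<in> {0..T}" for h t
  proof -
    (* the defect of the fundamental theorem of calculus at time t *)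
    define G where "G t = integral (cbox (-r) h) (\<lambda>k. \<psi> (x + k *\<^sub>R b, t))
      - (f (x + h *\<^sub>R b, t) - f (x + (-r) *\<^sub>R b, t))" for t
    have "continuous_on ({0..T} \<times> cbox (-r) h) (\<lambda>(t, k). \<psi> (x + k *\<^sub>R b, t))"
      unfolding case_prod_beta
      using h by (intro continuous_on_compose2[OF smooth_closure_continuous[OF \<psi>]] continuous_intros)
        (auto intro!: clU)
    then have "continuous_on {0..T} G"
      unfolding G_def[abs_def] using h r
      by (intro continuous_intros integral_continuous_on_param cont_t) auto
    moreover have "G t = 0" if t: "t \<in> {0<..<T}" for t
    proof -
      have "((\<lambda>k. \<psi> (x + k *\<^sub>R b, t)) has_integral f (x + h *\<^sub>R b, t) - f (x + (-r) *\<^sub>R b, t)) {-r..h}"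
      proof (rule fundamental_theorem_of_calculus)
        show "((\<lambda>k. f (x + k *\<^sub>R b, t)) has_vector_derivative \<psi> (x + k *\<^sub>R b, t)) (at k within {-r..h})"
          if k: "k \<in> {-r..h}" for k
          using smooth_closure_line_derivative[OF f b0, of "(x, t)" k] D[of k] k h t
          by (auto simp: \<psi>_def U_def intro: has_vector_derivative_at_within)
      qed (use h in auto)
      then show ?thesis by (simp add: G_def integral_unique)
    qed
    ultimately have "G t = 0"
      using continuous_constant_on_closure[of "{0<..<T}" G 0 t] t \<open>0 < T\<close> by simp
    then show ?thesis by (simp add: G_def)
  qed
  have "continuous_on {-r..r} (\<lambda>k. \<psi> (x + k *\<^sub>R b, t))"
    using clU[OF _ \<open>t \<in> {0..T}\<close>]
    by (intro continuous_on_compose2[OF smooth_closure_continuous[OF \<psi>]] continuous_intros) auto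
  then have "((\<lambda>h. f (x + h *\<^sub>R b, t)) has_vector_derivative \<psi> (x + 0 *\<^sub>R b, t)) (at 0 within {-r..r})"
    by (rule has_vector_derivative_of_integral_eq[where t = 0 and a = "-r" and b = r
          and \<phi> = "\<lambda>h. f (x + h *\<^sub>R b, t)" and \<psi> = "\<lambda>h. \<psi> (x + h *\<^sub>R b, t)", rotated])
      (use r(1) ftc[OF _ \<open>t \<in> {0..T}\<close>] in simp_all)
  moreover have "at 0 within {-r..r} = at 0"
    using r(1) by (intro at_within_interior) simp
  ultimately show ?thesis
    by (simp add: \<psi>_def U_def)
qed

section \<open>The Laplacian of a combination of time slices\<close>

text \<open>
  The combination \<open>g\<close> need be known on \<open>D\<close> only. This makes the lemma applicable twice in
  succession: after the first application the derivative of the combination is again of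
  the given form on \<open>D\<close>, with \<open>f\<close> replaced by its extended derivative.
\<close>
lemma ext_pderiv_time_slices:
  fixes f :: "'a::euclidean_space \<times> real \<Rightarrow> 'b::banach"
  assumes f: "smooth_closure (D \<times> {0<..<T}) f" and "open D" "x \<in> D" "0 < T" and b: "b \<in> Basis"
    and ts: "\<And>j. j \<in> J \<Longrightarrow> ts j \<in> {0..T}"
    and g: "\<And>y. y \<in> D \<Longrightarrow> g y = (\<Sum>j\<in>J. c j *\<^sub>R f (y, ts j))"
  shows "ext_pderiv D b g x = (\<Sum>j\<in>J. c j *\<^sub>R ext_pderiv (D \<times> {0<..<T}) (b, 0) f (x, ts j))"
proof -
  have "((\<lambda>h. \<Sum>j\<in>J. c j *\<^sub>R f (x + h *\<^sub>R b, ts j)) has_vector_derivative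
      (\<Sum>j\<in>J. c j *\<^sub>R ext_pderiv (D \<times> {0<..<T}) (b, 0) f (x, ts j))) (at 0)"
    using assms by (intro has_vector_derivative_sum
        bounded_linear.has_vector_derivative[OF bounded_linear_scaleR_right]
        smooth_closure_space_derivative) auto
  moreover have "\<forall>\<^sub>F h in nhds 0. (\<Sum>j\<in>J. c j *\<^sub>R f (x + h *\<^sub>R b, ts j)) = g (x + h *\<^sub>R b)"
  proof -
    have "open ((\<lambda>h. x + h *\<^sub>R b) -` D)"
      using \<open>open D\<close> by (intro open_vimage continuous_intros)
    then have "\<forall>\<^sub>F h in nhds 0. h \<in> (\<lambda>h. x + h *\<^sub>R b) -` D"
      using \<open>x \<in> D\<close> by (intro eventually_nhds_in_open) auto
    then show ?thesis by eventually_elim (simp add: g)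
  qed
  ultimately have "((\<lambda>h. g (x + h *\<^sub>R b)) has_vector_derivative
      (\<Sum>j\<in>J. c j *\<^sub>R ext_pderiv (D \<times> {0<..<T}) (b, 0) f (x, ts j))) (at 0)"
    by (subst (asm) has_vector_derivative_cong_ev[where g = "\<lambda>h. g (x + h *\<^sub>R b)"])
      (auto dest: eventually_nhds_x_imp_x elim: eventually_mono)
  then show ?thesis
    using \<open>x \<in> D\<close> by (simp add: ext_pderiv_def vector_derivative_at)
qed

lemma laplacian_time_slices:
  fixes f :: "'a::euclidean_space \<times> real \<Rightarrow> 'b::banach"
  assumes f: "smooth_closure (D \<times> {0<..<T}) f" and "open D" "x \<in> D" "0 < T"
    and ts: "\<And>j. j \<in> J \<Longrightarrow> ts j \<in> {0..T}"
  shows "laplacian D (\<lambda>y. \<Sum>j\<in>J. c j *\<^sub>R f (y, ts j)) x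
    = (\<Sum>b\<in>Basis. \<Sum>j\<in>J. c j *\<^sub>R
         ext_pderiv (D \<times> {0<..<T}) (b, 0) (ext_pderiv (D \<times> {0<..<T}) (b, 0) f) (x, ts j))"
  unfolding laplacian_def
proof (intro sum.cong refl)
  fix b :: 'a assume b: "b \<in> Basis"
  then have "smooth_closure (D \<times> {0<..<T}) (ext_pderiv (D \<times> {0<..<T}) (b, 0) f)"
    by (intro smooth_closure_ext_pderiv f) (simp add: Basis_prod_def)
  then show "ext_pderiv D b (ext_pderiv D b (\<lambda>y. \<Sum>j\<in>J. c j *\<^sub>R f (y, ts j))) x = (\<Sum>j\<in>J. c j *\<^sub>R
         ext_pderiv (D \<times> {0<..<T}) (b, 0) (ext_pderiv (D \<times> {0<..<T}) (b, 0) f) (x, ts j))"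
    using assms b
    by (intro ext_pderiv_time_slices) auto
qed

section \<open>Consistency of the modified scheme\<close>

text \<open>
  The iterated time derivatives in the form that \<open>taylor_backward\<close> requires, with bounds
  uniform in \<open>x\<close>.
\<close>
lemma smooth_closure_time_tower:
  fixes f :: "'a::euclidean_space \<times> real \<Rightarrow> 'b::banach"
  assumes f: "smooth_closure (D \<times> {0<..<T}) f" and "bounded D" "0 < T"
  obtains F :: "nat \<Rightarrow> 'a \<Rightarrow> real \<Rightarrow> 'b" and M :: "nat \<Rightarrow> real"
    where "\<And>x. F 0 x = (\<lambda>t. f (x, t))"
    and "\<And>i x t. x \<in> D \<Longrightarrow> t \<in> {0..T} \<Longrightarrow>
           (F i x has_vector_derivative F (Suc i) x t) (at t within {0..T})"
    and "\<And>i x t. x \<in> D \<Longrightarrow> t \<in> {0..T} \<Longrightarrow> norm (F i x t) \<le> M i"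
proof -
  define U where "U = D \<times> {0<..<T}"
  define G where "G i = (ext_pderiv U (0, 1) ^^ i) f" for i
  have G: "smooth_closure U (G i)" for i
    unfolding G_def U_def by (intro smooth_closure_funpow_ext_pderiv f) (simp add: Basis_prod_def)
  have "bounded U" unfolding U_def using \<open>bounded D\<close> by (intro bounded_Times) auto
  then have "\<forall>i. \<exists>M. \<forall>p\<in>closure U. norm (G i p) \<le> M"
    by (metis G smooth_closure_bounded)
  then obtain M where M: "\<And>i p. p \<in> closure U \<Longrightarrow> norm (G i p) \<le> M i" by metis
  show thesis
  proof (rule that[of "\<lambda>i x t. G i (x, t)" M])
    show "((\<lambda>t. G i (x, t)) has_vector_derivative G (Suc i) (x, t)) (at t within {0..T})"
      if "x \<in> D" "t \<in> {0..T}" for i x t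
      using smooth_closure_time_derivative[OF G[of i, unfolded U_def] that(1) \<open>0 < T\<close> that(2)]
      by (simp add: G_def U_def)
    show "norm (G i (x, t)) \<le> M i" if "x \<in> D" "t \<in> {0..T}" for i x t
      using that closure_subset[of D] \<open>0 < T\<close> by (intro M) (auto simp: U_def closure_Times)
  qed (simp add: G_def)
qed

lemma shift_avg_mean_uniform:
  fixes f :: "'a::euclidean_space \<times> real \<Rightarrow> 'b::banach"
  assumes f: "smooth_closure (D \<times> {0<..<T}) f" and "bounded D" "0 < T"
    and moments: "(\<Sum>j<s. \<beta> j) = 1" "(\<Sum>j<s. real j * \<beta> j) = - 1 / 2"
  shows "\<exists>A. \<forall>x\<in>D. \<forall>\<tau>>0. \<forall>t. real s * \<tau> \<le> t \<and> t \<le> T \<longrightarrow>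
    norm ((1/2) *\<^sub>R (shift_avg s \<beta> \<tau> 0 (\<lambda>t. f (x, t)) t + shift_avg s \<beta> \<tau> 1 (\<lambda>t. f (x, t)) t) - f (x, t))
      \<le> A * \<tau>\<^sup>2"
proof -
  from smooth_closure_time_tower[OF f assms(2,3)] obtain F M
    where F: "\<And>x. F 0 x = (\<lambda>t. f (x, t))"
      "\<And>i x t. x \<in> D \<Longrightarrow> t \<in> {0..T} \<Longrightarrow> (F i x has_vector_derivative F (Suc i) x t) (at t within {0..T})"
      "\<And>i x t. x \<in> D \<Longrightarrow> t \<in> {0..T} \<Longrightarrow> norm (F i x t) \<le> (M i :: real)"
    by blast
  have "norm ((1/2) *\<^sub>R (shift_avg s \<beta> \<tau> 0 (F 0 x) t + shift_avg s \<beta> \<tau> 1 (F 0 x) t) - F 0 x t)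
      \<le> (\<Sum>j<s. \<bar>\<beta> j\<bar>) * (M 2 * (real s)\<^sup>2) * \<tau>\<^sup>2"
    if "x \<in> D" "0 < \<tau>" "real s * \<tau> \<le> t" "t \<le> T" for x \<tau> t
    using F(2,3)[OF that(1)] moments that(2-) by (rule shift_avg_mean[where F = "\<lambda>i. F i x"])
  then show ?thesis unfolding F(1) by blast
qed

lemma shift_avg_difference_uniform:
  fixes f :: "'a::euclidean_space \<times> real \<Rightarrow> 'b::banach"
  assumes f: "smooth_closure (D \<times> {0<..<T}) f" and "bounded D" "0 < T"
    and moments: "(\<Sum>j<s. \<beta> j) = 1" "(\<Sum>j<s. real j * \<beta> j) = - 1 / 2"
  shows "\<exists>A. \<forall>x\<in>D. \<forall>\<tau>>0. \<forall>t. real s * \<tau> \<le> t \<and> t \<le> T \<longrightarrow>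
    norm (shift_avg s \<beta> \<tau> 0 (\<lambda>t. f (x, t)) t - shift_avg s \<beta> \<tau> 1 (\<lambda>t. f (x, t)) t
      - \<tau> *\<^sub>R vector_derivative (\<lambda>t. f (x, t)) (at t within {0..T})) \<le> A * \<tau> ^ 3"
proof -
  from smooth_closure_time_tower[OF f assms(2,3)] obtain F M
    where F: "\<And>x. F 0 x = (\<lambda>t. f (x, t))"
      "\<And>i x t. x \<in> D \<Longrightarrow> t \<in> {0..T} \<Longrightarrow> (F i x has_vector_derivative F (Suc i) x t) (at t within {0..T})"
      "\<And>i x t. x \<in> D \<Longrightarrow> t \<in> {0..T} \<Longrightarrow> norm (F i x t) \<le> (M i :: real)"
    by blast
  have "norm (shift_avg s \<beta> \<tau> 0 (F 0 x) t - shift_avg s \<beta> \<tau> 1 (F 0 x) t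
      - \<tau> *\<^sub>R vector_derivative (F 0 x) (at t within {0..T}))
        \<le> (\<Sum>j<s. \<bar>\<beta> j\<bar>) * (2 * M 3 * real s ^ 3) * \<tau> ^ 3"
    if "x \<in> D" "0 < \<tau>" "real s * \<tau> \<le> t" "t \<le> T" for x \<tau> t
  proof -
    have "0 \<le> real s * \<tau>" using that by (intro mult_nonneg_nonneg) auto
    then have "0 \<le> t" using that(3) by linarith
    with that(4) have "t \<in> {0..T}" by simp
    then have "vector_derivative (F 0 x) (at t within {0..T}) = F 1 x t"
      using F(2)[of x t 0] that(1) \<open>0 < T\<close> by (intro vector_derivative_within_cbox[of 0 T, unfolded cbox_interval]) auto
    then show ?thesis
      using shift_avg_difference[where F = "\<lambda>i. F i x", OF F(2,3)[OF that(1)] moments that(2-)]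
      by (elim ssubst)
  qed
  then show ?thesis unfolding F(1) by blast
qed

theorem lemma3p3:
  fixes D :: "(real ^ 'n) set" and T lam :: real and s :: nat
    and u :: "real ^ 'n \<Rightarrow> real \<Rightarrow> complex"
  assumes "CARD('n) \<in> {1, 2, 3}"
    and "open D" and "connected D" and "D \<noteq> {}" and "bounded D"
    and "T > 0"
    and "s \<in> {2, 3, 4, 5, 6}"
    and "lam \<in> {1, -1}"
    and "smooth_closure (D \<times> {0<..<T}) (\<lambda>(x, t). u x t)"
    and "nls_solution D T lam u"
  shows "\<exists>C::real. \<forall>\<tau>>0. \<forall>n::nat. n \<ge> s - 1 \<and> real (n + 1) * \<tau> \<le> T \<longrightarrow>
           (\<forall>x\<in>D. cmod (trunc_err D s lam \<tau> u n x) \<le> C * \<tau>\<^sup>2)"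
proof -
  define U where "U = D \<times> {0<..<T}"
  define f where "f = (\<lambda>(x, t). u x t)"
  define \<beta> where "\<beta> = bdf_beta s"
  define w where "w b = ext_pderiv U (b, 0) (ext_pderiv U (b, 0) f)" for b
  have f: "smooth_closure U f" using assms(9) by (simp add: f_def U_def)
  have w: "smooth_closure U (w b)" if "b \<in> Basis" for b
    unfolding w_def using that by (intro smooth_closure_ext_pderiv f) (auto simp: Basis_prod_def)
  have moments: "(\<Sum>j<s. \<beta> j) = 1" "(\<Sum>j<s. real j * \<beta> j) = - 1 / 2"
    unfolding \<beta>_def by (rule bdf_beta_moments[OF assms(7)])+
  have u_f: "u y = (\<lambda>t. f (y, t))" for y by (simp add: f_def)
  let ?S = "\<lambda>\<tau> k g t. shift_avg s \<beta> \<tau> k g t"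

  note uniform = f[unfolded U_def] \<open>bounded D\<close> \<open>T > 0\<close> moments
  obtain A where A: "cmod ((?S \<tau> 0 (u x) t + ?S \<tau> 1 (u x) t) / 2 - u x t) \<le> A * \<tau>\<^sup>2"
    if "x \<in> D" "0 < \<tau>" "real s * \<tau> \<le> t" "t \<le> T" for x \<tau> t
    using shift_avg_mean_uniform[OF uniform] unfolding u_f by (auto simp: scaleR_conv_of_real)
  obtain B where B: "cmod (?S \<tau> 0 (u x) t - ?S \<tau> 1 (u x) t
      - \<tau> *\<^sub>R vector_derivative (u x) (at t within {0..T})) \<le> B * \<tau> ^ 3"
    if "x \<in> D" "0 < \<tau>" "real s * \<tau> \<le> t" "t \<le> T" for x \<tau> t
    using shift_avg_difference_uniform[OF uniform] unfolding u_f by blast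
  have "\<forall>b\<in>Basis. \<exists>W. \<forall>x\<in>D. \<forall>\<tau>>0. \<forall>t. real s * \<tau> \<le> t \<and> t \<le> T \<longrightarrow>
      norm ((1/2) *\<^sub>R (?S \<tau> 0 (\<lambda>t. w b (x, t)) t + ?S \<tau> 1 (\<lambda>t. w b (x, t)) t) - w b (x, t)) \<le> W * \<tau>\<^sup>2"
    using shift_avg_mean_uniform[OF w[unfolded U_def] uniform(2-)] by blast
  then obtain W where "\<forall>b\<in>Basis. \<forall>x\<in>D. \<forall>\<tau>>0. \<forall>t. real s * \<tau> \<le> t \<and> t \<le> T \<longrightarrow>
      norm ((1/2) *\<^sub>R (?S \<tau> 0 (\<lambda>t. w b (x, t)) t + ?S \<tau> 1 (\<lambda>t. w b (x, t)) t) - w b (x, t)) \<le> W b * \<tau>\<^sup>2"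
    unfolding bchoice_iff by blast
  then have W: "cmod ((?S \<tau> 0 (\<lambda>t. w b (x, t)) t + ?S \<tau> 1 (\<lambda>t. w b (x, t)) t) / 2 - w b (x, t)) \<le> W b * \<tau>\<^sup>2"
    if "b \<in> Basis" "x \<in> D" "0 < \<tau>" "real s * \<tau> \<le> t" "t \<le> T" for b x \<tau> t
    using that by (simp add: scaleR_conv_of_real)
  from smooth_closure_time_tower[OF uniform(1-3)] obtain F M
    where F0: "\<And>x. F 0 x = (\<lambda>t. f (x, t))"
      and F: "\<And>i x t. x \<in> D \<Longrightarrow> t \<in> {0..T} \<Longrightarrow> (F i x has_vector_derivative F (Suc i) x t) (at t within {0..T})"
      and M: "\<And>i x t. x \<in> D \<Longrightarrow> t \<in> {0..T} \<Longrightarrow> cmod (F i x t) \<le> (M i :: real)"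
    by blast
  have u_F: "u x = F 0 x" for x by (simp add: F0 u_f)
  have u_t: "vector_derivative (u x) (at t within {0..T}) = F 1 x t" if "x \<in> D" "t \<in> {0..T}" for x t
    using F[of x t 0] that \<open>T > 0\<close> unfolding u_F
    by (intro vector_derivative_within_cbox[of 0 T, unfolded cbox_interval]) auto

  (* K bounds the difference quotient of R and N the mean of R; the powers of \<tau> in excess are
     absorbed by \<tau> \<le> T *)
  define K where "K = M 1 + \<bar>B\<bar> * T\<^sup>2"
  define N where "N = M 0 + \<bar>A\<bar> * T\<^sup>2"
  define C where "C = B + (\<Sum>b\<in>Basis. W b) + (A * (N\<^sup>2 + N * M 0 + (M 0)\<^sup>2) + K\<^sup>2 / 4 * N)"
  have "cmod (trunc_err D s lam \<tau> u n x) \<le> C * \<tau>\<^sup>2"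
    if "0 < \<tau>" "s - 1 \<le> n" "real (n + 1) * \<tau> \<le> T" "x \<in> D" for \<tau> n x
  proof -
    define t where "t = real (n + 1) * \<tau>"
    have s: "1 \<le> s" using assms(7) by auto
    have st: "real s * \<tau> \<le> t"
      unfolding t_def using that s by (intro mult_right_mono) auto
    have tT: "t \<le> T" using that by (simp add: t_def)
    have "\<tau> \<le> real s * \<tau>" using s \<open>0 < \<tau>\<close> by simp
    then have "\<tau> \<le> t" using st by linarith
    then have "\<tau> \<le> T" "t \<in> {0..T}" using tT \<open>0 < \<tau>\<close> by auto
    note t = st tT this
    note xt = \<open>x \<in> D\<close> \<open>0 < \<tau>\<close> t(1,2)
    have \<tau>2: "\<tau>\<^sup>2 \<le> T\<^sup>2" using t(3) \<open>0 < \<tau>\<close> by (intro power_mono) auto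
    define R where "R k y = ?S \<tau> k (u y) t" for k y
    define v where "v = vector_derivative (u x) (at t within {0..T})"
    define L where "L = (\<Sum>b\<in>Basis. w b (x, t))"
    have R: "bdf_R s \<tau> u (n + 1) = R 0" "bdf_R s \<tau> u n = R 1"
      by (auto simp: fun_eq_iff bdf_R_def R_def shift_avg_def scaleR_conv_of_real \<beta>_def t_def algebra_simps)
    (* n \<ge> s - 1 keeps the earliest time, t - s \<tau>, from being negative *)
    have slice: "t - real (j + k) * \<tau> \<in> {0..T}" if "j < s" "k \<le> 1" for j k
    proof -
      have "real (j + k) * \<tau> \<le> real s * \<tau>" "0 \<le> real (j + k) * \<tau>"
        using that \<open>0 < \<tau>\<close> by (auto intro!: mult_right_mono)
      then show ?thesis using t by auto
    qed
    have lap_R: "laplacian D (R k) x = (\<Sum>b\<in>Basis. ?S \<tau> k (\<lambda>t. w b (x, t)) t)" if "k \<le> 1" for k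
      unfolding R_def[abs_def] shift_avg_def u_f w_def U_def
      using slice that by (intro laplacian_time_slices uniform assms(2) xt) auto
    have lap_u: "laplacian D (\<lambda>y. u y t) x = L"
      using laplacian_time_slices[OF uniform(1) assms(2) xt(1) \<open>T > 0\<close>, of "{0::nat}" "\<lambda>_. t" "\<lambda>_. 1"] t(4)
      by (simp add: u_f L_def w_def U_def)
    have pde: "\<i> * v + L - of_real lam * of_real ((cmod (u x t))\<^sup>2) * u x t = 0"
      using assms(10) xt(1) t(4) closure_subset[of D]
      unfolding nls_solution_def v_def lap_u[symmetric] by blast

    define cub where "cub = of_real ((cmod (R 0 x))\<^sup>2 + (cmod (R 1 x))\<^sup>2) * (R 0 x + R 1 x) / 4
        - of_real ((cmod (u x t))\<^sup>2) * u x t"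
    define err_t where "err_t = \<i> / of_real \<tau> * (R 0 x - R 1 x - \<tau> *\<^sub>R v)"
    define err_L where "err_L = (\<Sum>b\<in>Basis. (?S \<tau> 0 (\<lambda>t. w b (x, t)) t + ?S \<tau> 1 (\<lambda>t. w b (x, t)) t) / 2 - w b (x, t))"
    have err_L: "err_L = 1 / 2 * (laplacian D (R 0) x + laplacian D (R 1) x) - L"
      by (simp add: err_L_def lap_R L_def sum_subtractf sum.distrib flip: sum_divide_distrib)
    have err_t: "err_t = \<i> / of_real \<tau> * (R 0 x - R 1 x) - \<i> * v"
      using \<open>0 < \<tau>\<close> by (simp add: err_t_def scaleR_conv_of_real field_simps)
    have trunc: "trunc_err D s lam \<tau> u n x = \<i> / of_real \<tau> * (R 0 x - R 1 x)
        + 1 / 2 * (laplacian D (R 0) x + laplacian D (R 1) x)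
        - of_real (lam / 4) * of_real ((cmod (R 0 x))\<^sup>2 + (cmod (R 1 x))\<^sup>2) * (R 0 x + R 1 x)"
      unfolding trunc_err_def Let_def R ..
    have cubic: "of_real (lam / 4) * of_real ((cmod (R 0 x))\<^sup>2 + (cmod (R 1 x))\<^sup>2) * (R 0 x + R 1 x)
        = of_real lam * cub + of_real lam * of_real ((cmod (u x t))\<^sup>2) * u x t"
      by (simp add: cub_def algebra_simps add_divide_distrib)
    have "trunc_err D s lam \<tau> u n x = err_t + err_L - of_real lam * cub
        + (\<i> * v + L - of_real lam * of_real ((cmod (u x t))\<^sup>2) * u x t)"
      unfolding trunc cubic err_t err_L by (simp only: algebra_simps)
    then have "cmod (trunc_err D s lam \<tau> u n x) = cmod (err_t + err_L - of_real lam * cub)"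
      unfolding pde by simp
    also have "\<dots> \<le> cmod err_t + cmod err_L + cmod (of_real lam * cub)"
      by (rule order_trans[OF norm_triangle_ineq4 add_right_mono[OF norm_triangle_ineq]])
    also have "cmod (of_real lam * cub) = cmod cub"
      using assms(8) by (auto simp: norm_mult)
    also have "cmod err_t \<le> B * \<tau>\<^sup>2"
      using B[OF xt] \<open>0 < \<tau>\<close>
      by (simp add: err_t_def norm_mult norm_divide R_def v_def divide_simps power2_eq_square power3_eq_cube mult_ac)
    also have "cmod err_L \<le> (\<Sum>b\<in>Basis. W b) * \<tau>\<^sup>2"
      unfolding err_L_def sum_distrib_right by (intro sum_norm_le W xt)
    also have "cmod cub \<le> (A * (N\<^sup>2 + N * M 0 + (M 0)\<^sup>2) + K\<^sup>2 / 4 * N) * \<tau>\<^sup>2"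
      unfolding cub_def
    proof (rule cubic_consistency)
      show mean: "cmod ((R 0 x + R 1 x) / 2 - u x t) \<le> A * \<tau>\<^sup>2"
        unfolding R_def by (rule A[OF xt])
      show u: "cmod (u x t) \<le> M 0"
        unfolding u_F by (rule M[OF xt(1) t(4)])
      have "A * \<tau>\<^sup>2 \<le> \<bar>A\<bar> * T\<^sup>2" using \<tau>2 by (intro mult_mono) auto
      then show "cmod ((R 0 x + R 1 x) / 2) \<le> N"
        using mean u norm_triangle_sub[of "(R 0 x + R 1 x) / 2" "u x t"] by (simp add: N_def)
      have "cmod (R 0 x - R 1 x) \<le> cmod (\<tau> *\<^sub>R v) + B * \<tau> ^ 3"
        using B[OF xt] norm_triangle_sub[of "R 0 x - R 1 x" "\<tau> *\<^sub>R v"] by (simp add: R_def v_def)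
      also have "cmod (\<tau> *\<^sub>R v) \<le> M 1 * \<tau>"
        using M[OF xt(1) t(4), of 1] \<open>0 < \<tau>\<close> by (simp add: v_def u_t[OF xt(1) t(4)])
      also have "B * \<tau> ^ 3 \<le> \<bar>B\<bar> * T\<^sup>2 * \<tau>"
      proof -
        have "B * \<tau>\<^sup>2 \<le> \<bar>B\<bar> * T\<^sup>2" using \<tau>2 by (intro mult_mono) auto
        from mult_right_mono[OF this, of \<tau>] show ?thesis
          using \<open>0 < \<tau>\<close> by (simp add: power3_eq_cube power2_eq_square mult_ac)
      qed
      finally show "cmod (R 0 x - R 1 x) \<le> K * \<tau>" by (simp add: K_def algebra_simps)
    qed
    finally show ?thesis by (simp add: C_def algebra_simps)
  qed
  then show ?thesis by blast
qed

end
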